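(* Let $D\subseteq\mathbb{C}$ be a domain, let $\mathcal{F}$ and $\mathcal{G}$ be two families of meromorphic functions on $D$, and let $a_1,a_2,a_3\in\mathbb{C}_\infty$ be three distinct values. Suppose that $\mathcal{G}$ is normal in $D$ and that all limit functions of $\mathcal{G}$ are non-constant. If for each $f\in\mathcal{F}$ there exists $g\in\mathcal{G}$ such that $f$ and $g$ share $a_j$ partially in $D$ for each $j=1,2,3$, then $\mathcal{F}$ is normal in $D$.
   Context: $\mathbb{C}_\infty=\mathbb{C}\cup\{\infty\}$ is the extended complex plane. A family of meromorphic functions on $D$ is normal in $D$ if every sequence in the family has a subsequence converging spherically locally uniformly in $D$; the limit is either a meromorphic function on $D$ or identically equal to $\infty$. A limit function of $\mathcal{G}$ is the spherical locally uniform limit in $D$ of a sequence of (not necessarily distinct) elements of $\mathcal{G}$; the limit $\equiv\infty$ counts as constant. For a meromorphic function $f$ on $D$ and $a\in\mathbb{C}_\infty$, $\bar{E}(f,a)=\{z\in D: f(z)=a\}$ (multiplicities ignored). Two meromorphic functions $f,g$ on $D$ are said to share $a$ partially if $\bar{E}(f,a)\subseteq\bar{E}(g,a)$ (in this order: every $a$-point of $f$ is an $a$-point of $g$). *)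

theory Defs
  imports "HOL-Complex_Analysis.Complex_Analysis"
begin

datatype ext_complex = Fin complex | Infty

text \<open>Inverse stereographic projection onto the unit sphere, the north pole being the image of
  the point at infinity.\<close>

fun to_sphere :: "ext_complex \<Rightarrow> complex \<times> real" where
  "to_sphere (Fin z) =
     ((2 / (1 + (cmod z)\<^sup>2)) *\<^sub>R z, ((cmod z)\<^sup>2 - 1) / (1 + (cmod z)\<^sup>2))"
| "to_sphere Infty = (0, 1)"

lemma one_plus_cmod_sq_pos: "1 + (cmod z)\<^sup>2 > 0"
  by (simp add: add_pos_nonneg)

lemma to_sphere_snd_ne_1: "((cmod z)\<^sup>2 - 1) / (1 + (cmod z)\<^sup>2) \<noteq> 1"
  using one_plus_cmod_sq_pos[of z] by (simp add: field_simps)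

lemma to_sphere_eq_iff: "to_sphere x = to_sphere y \<longleftrightarrow> x = y"
proof
  assume eq: "to_sphere x = to_sphere y"
  show "x = y"
  proof (cases x; cases y)
    fix z w assume xy: "x = Fin z" "y = Fin w"
    have "((cmod z)\<^sup>2 - 1) / (1 + (cmod z)\<^sup>2) = ((cmod w)\<^sup>2 - 1) / (1 + (cmod w)\<^sup>2)"
      using eq xy by simp
    hence "(cmod z)\<^sup>2 = (cmod w)\<^sup>2"
      using one_plus_cmod_sq_pos[of z] one_plus_cmod_sq_pos[of w]
      by (simp add: field_simps)
    hence "(2 / (1 + (cmod z)\<^sup>2)) *\<^sub>R z = (2 / (1 + (cmod z)\<^sup>2)) *\<^sub>R w"
      using eq xy by simp
    thus "x = y"
      using one_plus_cmod_sq_pos[of z] xy by simp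
  next
    fix z assume "x = Fin z" "y = Infty"
    thus "x = y" using eq to_sphere_snd_ne_1[of z] by simp
  next
    fix z assume "x = Infty" "y = Fin z"
    thus "x = y" using eq to_sphere_snd_ne_1[of z] by simp
  qed simp
qed simp

text \<open>The chordal metric: Euclidean distance of the images on the unit sphere.\<close>

instantiation ext_complex :: metric_space
begin

definition dist_ext_complex :: "ext_complex \<Rightarrow> ext_complex \<Rightarrow> real" where
  "dist_ext_complex x y = dist (to_sphere x) (to_sphere y)"

definition uniformity_ext_complex :: "(ext_complex \<times> ext_complex) filter" where
  "uniformity_ext_complex = (INF e\<in>{0<..}. principal {(x, y). dist x y < e})"

definition open_ext_complex :: "ext_complex set \<Rightarrow> bool" where
  "open_ext_complex U \<longleftrightarrow> (\<forall>x\<in>U. eventually (\<lambda>(x', y). x' = x \<longrightarrow> y \<in> U) uniformity)"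

instance
proof
  fix x y z :: ext_complex
  show "dist x y = 0 \<longleftrightarrow> x = y"
    by (simp add: dist_ext_complex_def to_sphere_eq_iff)
  show "dist x y \<le> dist x z + dist y z"
    unfolding dist_ext_complex_def by (rule dist_triangle2)
qed (simp_all add: uniformity_ext_complex_def open_ext_complex_def)

end

lemma dist_Pair_sq: "(dist (a, b) (c, d))\<^sup>2 = (dist a c)\<^sup>2 + (dist b d)\<^sup>2"
  by (simp add: dist_Pair_Pair)

lemma dist_Fin_Infty: "dist (Fin z) Infty = 2 / sqrt (1 + (cmod z)\<^sup>2)"
proof -
  define s where "s = 1 + (cmod z)\<^sup>2"
  have s: "s > 0" "(cmod z)\<^sup>2 = s - 1"
    using one_plus_cmod_sq_pos[of z] by (simp_all add: s_def)
  have "(dist (Fin z) Infty)\<^sup>2 = (2 / s)\<^sup>2 * (cmod z)\<^sup>2 + ((s - 2) / s - 1)\<^sup>2"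
    unfolding dist_ext_complex_def to_sphere.simps dist_Pair_sq zero_prod_def
    using s by (simp add: dist_norm power_mult_distrib power_divide power2_commute flip: s_def)
  also have "\<dots> = 4 / s"
    unfolding s(2) using s(1) by (simp add: field_simps power2_eq_square)
  also have "\<dots> = (2 / sqrt s)\<^sup>2"
    using s(1) by (simp add: power_divide)
  finally show ?thesis
    unfolding s_def[symmetric] using s(1) by (subst (asm) power2_eq_iff_nonneg) auto
qed

lemma dist_Fin_Fin:
  "dist (Fin z) (Fin w) = 2 * cmod (z - w) / (sqrt (1 + (cmod z)\<^sup>2) * sqrt (1 + (cmod w)\<^sup>2))"
proof -
  define s t where "s = 1 + (cmod z)\<^sup>2" and "t = 1 + (cmod w)\<^sup>2"
  have pos: "s > 0" "t > 0"
    using one_plus_cmod_sq_pos by (simp_all add: s_def t_def)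
  have zw: "z \<bullet> z = s - 1" "w \<bullet> w = t - 1" "(cmod z)\<^sup>2 = s - 1" "(cmod w)\<^sup>2 = t - 1"
    by (simp_all add: s_def t_def dot_square_norm)
  define p where "p = z \<bullet> w"
  have p: "z \<bullet> w = p" "w \<bullet> z = p" by (simp_all add: p_def inner_commute)
  have 1: "(cmod ((2 / s) *\<^sub>R z - (2 / t) *\<^sub>R w))\<^sup>2
      = (2 / s)\<^sup>2 * (s - 1) - 2 * (2 / s) * (2 / t) * p + (2 / t)\<^sup>2 * (t - 1)"
    unfolding power2_norm_eq_inner
    using pos
    by (simp add: inner_diff_left inner_diff_right zw p power2_eq_square field_simps)
  have 2: "(cmod (z - w))\<^sup>2 = s + t - 2 - 2 * p"
    unfolding power2_norm_eq_inner
    by (simp add: inner_diff_left inner_diff_right zw p)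
  have "(dist (Fin z) (Fin w))\<^sup>2
      = (cmod ((2 / s) *\<^sub>R z - (2 / t) *\<^sub>R w))\<^sup>2 + ((s - 2) / s - (t - 2) / t)\<^sup>2"
    unfolding dist_ext_complex_def to_sphere.simps dist_Pair_sq
    by (simp add: dist_norm zw(3,4) flip: s_def t_def)
  also have "\<dots> = 4 * (cmod (z - w))\<^sup>2 / (s * t)"
    unfolding 1 2 using pos by (simp add: field_simps power2_eq_square)
  also have "\<dots> = (2 * cmod (z - w) / (sqrt s * sqrt t))\<^sup>2"
    using pos by (simp add: power_divide power_mult_distrib)
  finally show ?thesis
    unfolding s_def[symmetric] t_def[symmetric]
    using pos by (subst (asm) power2_eq_iff_nonneg) auto
qed

text \<open>A meromorphic function is represented by a \<^const>\<open>nicely_meromorphic_on\<close>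
  function into the complex numbers, whose value at a pole is the dummy \<open>0\<close>;
  \<open>sphere_val f\<close> is the corresponding map into the extended plane.\<close>

definition sphere_val :: "(complex \<Rightarrow> complex) \<Rightarrow> complex \<Rightarrow> ext_complex" where
  "sphere_val f z = (if is_pole f z then Infty else Fin (f z))"

definition loc_uniform_limit ::
  "complex set \<Rightarrow> (nat \<Rightarrow> complex \<Rightarrow> ext_complex) \<Rightarrow> (complex \<Rightarrow> ext_complex) \<Rightarrow> bool" where
  "loc_uniform_limit D fs h \<longleftrightarrow>
     (\<forall>z\<in>D. \<exists>U. open U \<and> z \<in> U \<and> U \<subseteq> D \<and> uniform_limit U fs h sequentially)"

text \<open>The limit \<open>h\<close> is an arbitrary map into the extended plane: that on a domain it is
  meromorphic or identically \<^const>\<open>Infty\<close> is a consequence of the convergence,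
  not a requirement.\<close>

definition limit_function ::
  "complex set \<Rightarrow> (complex \<Rightarrow> complex) set \<Rightarrow> (complex \<Rightarrow> ext_complex) \<Rightarrow> bool" where
  "limit_function D \<G> h \<longleftrightarrow>
     (\<exists>s. (\<forall>n. s n \<in> \<G>) \<and> loc_uniform_limit D (\<lambda>n. sphere_val (s n)) h)"

definition normal_family :: "complex set \<Rightarrow> (complex \<Rightarrow> complex) set \<Rightarrow> bool" where
  "normal_family D \<F> \<longleftrightarrow>
     (\<forall>s. (\<forall>n. s n \<in> \<F>) \<longrightarrow>
        (\<exists>r h. strict_mono (r :: nat \<Rightarrow> nat) \<and>
               loc_uniform_limit D (\<lambda>n. sphere_val (s (r n))) h))"

definition value_points ::
  "complex set \<Rightarrow> (complex \<Rightarrow> complex) \<Rightarrow> ext_complex \<Rightarrow> complex set" where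
  "value_points D f a = {z \<in> D. sphere_val f z = a}"

definition shares_partially ::
  "complex set \<Rightarrow> (complex \<Rightarrow> complex) \<Rightarrow> (complex \<Rightarrow> complex) \<Rightarrow> ext_complex \<Rightarrow> bool" where
  "shares_partially D f g a \<longleftrightarrow> value_points D f a \<subseteq> value_points D g a"

end

theory Submission
  imports Defs "HOL-Library.Diagonal_Subsequence"
begin

text \<open>Given a sequence in \<open>\<F>\<close>, pass to a subsequence along which the partner functions from
  \<open>\<G>\<close> converge to a limit \<open>h\<close>, which is meromorphic and non-constant. Near a point of \<open>D\<close>, \<open>h\<close>
  takes at most one of the three values, and that one only at the centre. Hence in a small disc
  almost all functions of the sequence omit two of the values, and in an annulus around the centre
  also the third. By Schottky's theorem in the annulus and the maximum principle in the disc,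
  this makes the sequence normal near the point, however often the third value is taken near the
  centre.\<close>

section \<open>Moebius transformations of the sphere\<close>

text \<open>The limit \<open>h\<close> arrives as a bare map into the sphere, so its analyticity has
  to be proved before an identity theorem can show that its values are isolated. To treat poles, the
  value infinity and the limit \<open>Infty\<close> alike, everything is phrased through
  \<open>sphere_analytic_at\<close>, which Moebius maps preserve; limits and values are studied
  after moving the value in question to 0, where ordinary complex analysis applies. Omission passes
  from \<open>h\<close> to the partners by compactness, and from a partner to its function by
  partial sharing: a point where the function took the value would be such a point of the partner.
  The value that \<open>h\<close> may take at the centre is the obstacle to applying Montel's
  criterion in the disc. It is normalised to 1, and the other two to infinity and 0, so that a
  function and its reciprocal are both holomorphic in the whole disc and a bound on a circle can be
  carried inward.\<close>

fun ext_inv :: "ext_complex \<Rightarrow> ext_complex" where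
  "ext_inv (Fin z) = (if z = 0 then Infty else Fin (1 / z))"
| "ext_inv Infty = Fin 0"

fun ext_affine :: "complex \<Rightarrow> complex \<Rightarrow> ext_complex \<Rightarrow> ext_complex" where
  "ext_affine m c (Fin z) = Fin (m * z + c)"
| "ext_affine m c Infty = Infty"

lemma ext_inv_ext_inv [simp]: "ext_inv (ext_inv x) = x"
  by (cases x) auto

lemma sqrt_one_plus_cmod_inverse:
  assumes "z \<noteq> 0"
  shows "sqrt (1 + (cmod (1 / z))\<^sup>2) = sqrt (1 + (cmod z)\<^sup>2) / cmod z"
proof -
  have "1 + (cmod (1 / z))\<^sup>2 = (1 + (cmod z)\<^sup>2) / (cmod z)\<^sup>2"
    using assms by (simp add: field_simps norm_divide)
  then show ?thesis
    by (simp add: real_sqrt_divide)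
qed

text \<open>Inversion is the half-turn of the sphere about the real axis, hence a chordal isometry;
  the cases are this fact computed in the plane.\<close>

lemma dist_ext_inv: "dist (ext_inv x) (ext_inv y) = dist x y"
proof -
  have zero: "dist Infty (Fin (1 / w)) = dist (Fin 0) (Fin w)" if "w \<noteq> 0" for w
    using that sqrt_one_plus_cmod_inverse[OF that]
    by (simp add: dist_commute[of Infty] dist_Fin_Infty dist_Fin_Fin)
  have infty: "dist (Fin 0) (Fin (1 / w)) = dist Infty (Fin w)" if "w \<noteq> 0" for w
    using zero[of "1 / w"] that by simp
  have fin: "dist (Fin (1 / z)) (Fin (1 / w)) = dist (Fin z) (Fin w)" if "z \<noteq> 0" "w \<noteq> 0" for z w
  proof -
    have "1 / z - 1 / w = (w - z) / (z * w)"
      using that by (simp add: field_simps)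
    then have "cmod (1 / z - 1 / w) = cmod (z - w) / (cmod z * cmod w)"
      by (simp add: norm_divide norm_mult norm_minus_commute)
    then show ?thesis
      unfolding dist_Fin_Fin sqrt_one_plus_cmod_inverse[OF that(1)] sqrt_one_plus_cmod_inverse[OF that(2)]
      using that by simp
  qed
  show ?thesis
    by (cases x; cases y) (auto simp: zero infty fin dist_commute zero[unfolded dist_commute[of Infty]] infty[unfolded dist_commute[of Infty]])
qed

text \<open>Up to a factor 2, chordal distance is Euclidean distance divided by the weights
  \<open>s\<close>. An affine map scales the Euclidean distance by \<open>cmod m\<close>, so only
  the weights have to be compared.\<close>

lemma ext_affine_lipschitz:
  assumes "m \<noteq> 0"
  obtains L where "\<And>x y. dist (ext_affine m c x) (ext_affine m c y) \<le> L * dist x y" "L > 0"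
proof -
  \<comment> \<open>With \<open>u = m * z + c\<close>, the square of \<open>cmod m * cmod z\<close>
    is at most twice the sum of the squares of \<open>cmod u\<close> and \<open>cmod c\<close>; the
    leading 1 absorbs the 1 in the weight of \<open>z\<close>.\<close>
  define C where "C = 1 + 2 * (1 + (cmod c)\<^sup>2) / (cmod m)\<^sup>2"
  have C1: "C \<ge> 1" by (simp add: C_def)
  define s where "s z = sqrt (1 + (cmod z)\<^sup>2)" for z
  have s1: "s z \<ge> 1" for z by (simp add: s_def)
  have bound: "s z \<le> sqrt C * s (m * z + c)" for z
  proof -
    define u where "u = m * z + c"
    have "cmod (m * z) \<le> cmod u + cmod c"
      using norm_triangle_ineq4[of u c] by (simp add: u_def)
    then have "(cmod m * cmod z)\<^sup>2 \<le> (cmod u + cmod c)\<^sup>2"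
      by (intro power_mono) (auto simp: norm_mult)
    also have "\<dots> \<le> 2 * (cmod u)\<^sup>2 + 2 * (cmod c)\<^sup>2"
      using sum_squares_bound[of "cmod u" "cmod c"] by (simp add: power2_sum)
    also have "\<dots> \<le> 2 * (1 + (cmod c)\<^sup>2) * (1 + (cmod u)\<^sup>2)"
      by (simp add: algebra_simps)
    finally have "(cmod z)\<^sup>2 \<le> 2 * (1 + (cmod c)\<^sup>2) / (cmod m)\<^sup>2 * (1 + (cmod u)\<^sup>2)"
      using assms by (simp add: power_mult_distrib field_simps)
    moreover have "1 \<le> 1 * (1 + (cmod u)\<^sup>2)" by simp
    ultimately have "1 + (cmod z)\<^sup>2 \<le> C * (1 + (cmod u)\<^sup>2)"
      unfolding C_def distrib_right by linarith
    then show ?thesis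
      by (simp add: s_def u_def flip: real_sqrt_mult)
  qed
  \<comment> \<open>Two finite points change both weights, at the cost \<open>cmod m * C\<close>; a
    finite point against \<open>Infty\<close> changes one, at the cost \<open>sqrt C\<close>. The
    sum serves both cases.\<close>
  define L where "L = cmod m * C + sqrt C"
  have fin: "dist (Fin (m * z + c)) (Fin (m * w + c)) \<le> L * dist (Fin z) (Fin w)" for z w
  proof -
    have pos: "s a > 0" for a using s1[of a] by linarith
    have "s z * s w \<le> (sqrt C * s (m * z + c)) * (sqrt C * s (m * w + c))"
      using s1[of z] s1[of w] s1[of "m * z + c"] C1 by (intro mult_mono bound) auto
    also have "\<dots> = C * (s (m * z + c) * s (m * w + c))"
      using C1 by simp
    finally have *: "1 / (s (m * z + c) * s (m * w + c)) \<le> C / (s z * s w)"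
      using pos by (simp add: field_simps)
    have "m * z + c - (m * w + c) = m * (z - w)" by (simp add: algebra_simps)
    then have "dist (Fin (m * z + c)) (Fin (m * w + c))
        = (2 * cmod m * cmod (z - w)) * (1 / (s (m * z + c) * s (m * w + c)))"
      by (simp add: dist_Fin_Fin s_def norm_mult)
    also have "\<dots> \<le> (2 * cmod m * cmod (z - w)) * (C / (s z * s w))"
      by (intro mult_left_mono *) auto
    also have "\<dots> = (cmod m * C) * dist (Fin z) (Fin w)"
      by (simp add: dist_Fin_Fin s_def)
    also have "\<dots> \<le> L * dist (Fin z) (Fin w)"
      using C1 by (intro mult_right_mono) (auto simp: L_def)
    finally show ?thesis .
  qed
  have inf: "dist (Fin (m * z + c)) Infty \<le> L * dist (Fin z) Infty" for z
  proof -
    have pos: "s a > 0" for a using s1[of a] by linarith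
    have "dist (Fin (m * z + c)) Infty = 2 / s (m * z + c)"
      by (simp add: dist_Fin_Infty s_def)
    also have "\<dots> \<le> sqrt C * (2 / s z)"
      using bound[of z] pos by (simp add: field_simps)
    also have "\<dots> \<le> L * (2 / s z)"
      using C1 pos[of z] by (intro mult_right_mono) (auto simp: L_def)
    finally show ?thesis by (simp add: dist_Fin_Infty s_def)
  qed
  have "dist (ext_affine m c x) (ext_affine m c y) \<le> L * dist x y" for x y
    using fin inf inf[unfolded dist_commute[of _ Infty]] by (cases x; cases y) auto
  moreover have "L > 0" using C1 by (auto simp: L_def intro: add_nonneg_pos)
  ultimately show ?thesis using that by blast
qed

text \<open>\<open>F\<close> is meromorphic at \<open>z\<close>, or identically \<^const>\<open>Infty\<close> near \<open>z\<close> (when \<open>g = 0\<close>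
  in the second case).\<close>

definition sphere_analytic_at :: "(complex \<Rightarrow> ext_complex) \<Rightarrow> complex \<Rightarrow> bool" where
  "sphere_analytic_at F z \<longleftrightarrow> (\<exists>g. g analytic_on {z} \<and>
     ((\<forall>\<^sub>F w in nhds z. F w = Fin (g w)) \<or> (\<forall>\<^sub>F w in nhds z. F w = ext_inv (Fin (g w)))))"

lemma sphere_analytic_atI1:
  "g analytic_on {z} \<Longrightarrow> \<forall>\<^sub>F w in nhds z. F w = Fin (g w) \<Longrightarrow> sphere_analytic_at F z"
  unfolding sphere_analytic_at_def by blast

lemma sphere_analytic_atI2:
  "g analytic_on {z} \<Longrightarrow> \<forall>\<^sub>F w in nhds z. F w = ext_inv (Fin (g w)) \<Longrightarrow> sphere_analytic_at F z"
  unfolding sphere_analytic_at_def by blast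

lemma eventually_nonzero_nhds:
  fixes g :: "complex \<Rightarrow> complex"
  assumes "g analytic_on {z}" "g z \<noteq> 0"
  shows "\<forall>\<^sub>F w in nhds z. g w \<noteq> 0"
  using analytic_at_imp_isCont[OF assms(1)] assms(2)
  by (metis isCont_def tendsto_at_iff_tendsto_nhds tendsto_imp_eventually_ne)

lemma sphere_analytic_at_ext_inv:
  assumes "sphere_analytic_at F z"
  shows "sphere_analytic_at (\<lambda>w. ext_inv (F w)) z"
proof -
  obtain g where g: "g analytic_on {z}"
    "(\<forall>\<^sub>F w in nhds z. F w = Fin (g w)) \<or> (\<forall>\<^sub>F w in nhds z. F w = ext_inv (Fin (g w)))"
    using assms unfolding sphere_analytic_at_def by blast
  show ?thesis
    using g(2)
  proof
    assume "\<forall>\<^sub>F w in nhds z. F w = Fin (g w)"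
    then have "\<forall>\<^sub>F w in nhds z. ext_inv (F w) = ext_inv (Fin (g w))"
      by eventually_elim simp
    then show ?thesis by (rule sphere_analytic_atI2[OF g(1)])
  next
    assume "\<forall>\<^sub>F w in nhds z. F w = ext_inv (Fin (g w))"
    then have "\<forall>\<^sub>F w in nhds z. ext_inv (F w) = Fin (g w)"
      by eventually_elim (simp del: ext_inv.simps)
    then show ?thesis by (rule sphere_analytic_atI1[OF g(1)])
  qed
qed

lemma sphere_analytic_at_ext_affine:
  assumes "sphere_analytic_at F z" "m \<noteq> 0"
  shows "sphere_analytic_at (\<lambda>w. ext_affine m c (F w)) z"
proof -
  obtain g where g: "g analytic_on {z}"
    "(\<forall>\<^sub>F w in nhds z. F w = Fin (g w)) \<or> (\<forall>\<^sub>F w in nhds z. F w = ext_inv (Fin (g w)))"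
    using assms unfolding sphere_analytic_at_def by blast
  show ?thesis
    using g(2)
  proof
    assume "\<forall>\<^sub>F w in nhds z. F w = Fin (g w)"
    then have *: "\<forall>\<^sub>F w in nhds z. ext_affine m c (F w) = Fin (m * g w + c)"
      by eventually_elim simp
    show ?thesis
      by (rule sphere_analytic_atI1[OF _ *]) (intro analytic_intros g(1))
  next
    assume F: "\<forall>\<^sub>F w in nhds z. F w = ext_inv (Fin (g w))"
    show ?thesis
    proof (cases "g z = 0")
      case True
      \<comment> \<open>Where \<open>F z\<close> is infinite the reciprocal chart must be kept:
        \<open>m / g w + c\<close> is the reciprocal of \<open>g w / (m + c * g w)\<close>, whose
        denominator equals \<open>m\<close> at \<open>z\<close>.\<close>
      have "(\<lambda>w. m + c * g w) analytic_on {z}" by (intro analytic_intros g(1))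
      then have "\<forall>\<^sub>F w in nhds z. m + c * g w \<noteq> 0"
        by (rule eventually_nonzero_nhds) (use True assms(2) in auto)
      then have *: "\<forall>\<^sub>F w in nhds z. ext_affine m c (F w) = ext_inv (Fin (g w / (m + c * g w)))"
        using F by eventually_elim (auto simp: field_simps)
      show ?thesis
        by (rule sphere_analytic_atI2[OF _ *]) (use True assms(2) in \<open>auto intro!: analytic_intros g(1)\<close>)
    next
      case False
      have "\<forall>\<^sub>F w in nhds z. g w \<noteq> 0"
        by (rule eventually_nonzero_nhds[OF g(1) False])
      then have *: "\<forall>\<^sub>F w in nhds z. ext_affine m c (F w) = Fin (m / g w + c)"
        using F by eventually_elim auto
      show ?thesis
        by (rule sphere_analytic_atI1[OF _ *]) (use False in \<open>auto intro!: analytic_intros g(1)\<close>)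
    qed
  qed
qed

text \<open>The two properties of Moebius maps that are used later: uniform continuity carries
  uniform limits across, and analytic maps stay analytic. Both survive composition, so it suffices
  to check inversion and affine maps.\<close>

definition sphere_map :: "(ext_complex \<Rightarrow> ext_complex) \<Rightarrow> bool" where
  "sphere_map \<phi> \<longleftrightarrow> uniformly_continuous_on UNIV \<phi> \<and>
     (\<forall>F z. sphere_analytic_at F z \<longrightarrow> sphere_analytic_at (\<lambda>w. \<phi> (F w)) z)"

text \<open>The inverse is an explicit argument because results obtained after a normalisation are
  carried back by it.\<close>

definition sphere_auto :: "(ext_complex \<Rightarrow> ext_complex) \<Rightarrow> (ext_complex \<Rightarrow> ext_complex) \<Rightarrow> bool" where
  "sphere_auto \<phi> \<psi> \<longleftrightarrow> sphere_map \<phi> \<and> sphere_map \<psi> \<and> (\<forall>x. \<psi> (\<phi> x) = x) \<and> (\<forall>x. \<phi> (\<psi> x) = x)"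

lemma sphere_map_ext_inv: "sphere_map ext_inv"
  unfolding sphere_map_def uniformly_continuous_on_def
  using sphere_analytic_at_ext_inv dist_ext_inv by metis

lemma sphere_map_ext_affine:
  assumes "m \<noteq> 0"
  shows "sphere_map (ext_affine m c)"
proof -
  obtain L where L: "\<And>x y. dist (ext_affine m c x) (ext_affine m c y) \<le> L * dist x y" "L > 0"
    using ext_affine_lipschitz[OF assms] by metis
  have "uniformly_continuous_on UNIV (ext_affine m c)"
    unfolding uniformly_continuous_on_def
  proof safe
    fix e :: real assume "e > 0"
    show "\<exists>d>0. \<forall>x\<in>UNIV. \<forall>x'\<in>UNIV. dist x' x < d \<longrightarrow> dist (ext_affine m c x') (ext_affine m c x) < e"
      using \<open>e > 0\<close> L by (intro exI[of _ "e / L"]) (auto simp: field_simps intro: le_less_trans)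
  qed
  then show ?thesis
    unfolding sphere_map_def using sphere_analytic_at_ext_affine[OF _ assms] by blast
qed

lemma sphere_map_comp:
  assumes "sphere_map \<phi>" "sphere_map \<psi>"
  shows "sphere_map (\<phi> \<circ> \<psi>)"
  using assms unfolding sphere_map_def uniformly_continuous_on_def o_def
  by (metis UNIV_I)

lemma sphere_auto_comp:
  assumes "sphere_auto \<phi> \<psi>" "sphere_auto \<phi>' \<psi>'"
  shows "sphere_auto (\<phi> \<circ> \<phi>') (\<psi>' \<circ> \<psi>)"
  using assms unfolding sphere_auto_def by (auto intro: sphere_map_comp)

lemma sphere_auto_ext_inv: "sphere_auto ext_inv ext_inv"
  by (simp add: sphere_auto_def sphere_map_ext_inv)

lemma sphere_auto_ext_affine:
  assumes "m \<noteq> 0"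
  shows "sphere_auto (ext_affine m c) (ext_affine (1 / m) (- c / m))"
proof -
  have "ext_affine (1 / m) (- c / m) (ext_affine m c x) = x" for x
    using assms by (cases x) (auto simp: field_simps)
  moreover have "ext_affine m c (ext_affine (1 / m) (- c / m) x) = x" for x
    using assms by (cases x) (auto simp: field_simps)
  ultimately show ?thesis
    using assms by (simp add: sphere_auto_def sphere_map_ext_affine)
qed

lemma sphere_auto_inj: "sphere_auto \<phi> \<psi> \<Longrightarrow> \<phi> x = \<phi> y \<longleftrightarrow> x = y"
  unfolding sphere_auto_def by metis

lemma sphere_auto_ex_Infty: "\<exists>\<phi> \<psi>. sphere_auto \<phi> \<psi> \<and> \<phi> a = Infty"
proof (cases a)
  case (Fin z)
  have "sphere_auto (ext_inv \<circ> ext_affine 1 (- z)) (ext_affine (1 / 1) (- (- z) / 1) \<circ> ext_inv)"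
    by (intro sphere_auto_comp sphere_auto_ext_inv sphere_auto_ext_affine) simp
  then show ?thesis using Fin by fastforce
next
  case Infty
  have "sphere_auto (ext_inv \<circ> ext_inv) (ext_inv \<circ> ext_inv)"
    by (intro sphere_auto_comp sphere_auto_ext_inv)
  then show ?thesis using Infty by fastforce
qed

text \<open>Once \<open>a\<close> is sent to \<open>Infty\<close>, the images of \<open>b\<close>
  and \<open>c\<close> are finite, and an affine map, which fixes \<open>Infty\<close>, moves them
  to 0 and 1.\<close>

lemma sphere_auto_ex:
  assumes "a \<noteq> b" "a \<noteq> c" "b \<noteq> c"
  obtains \<phi> \<psi> where "sphere_auto \<phi> \<psi>" "\<phi> a = Infty" "\<phi> b = Fin 0" "\<phi> c = Fin 1"
proof -
  obtain \<phi> \<psi> where 1: "sphere_auto \<phi> \<psi>" "\<phi> a = Infty"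
    using sphere_auto_ex_Infty by blast
  then have "\<phi> b \<noteq> Infty" "\<phi> c \<noteq> Infty" "\<phi> b \<noteq> \<phi> c"
    using assms sphere_auto_inj[OF 1(1)] by metis+
  then obtain p q where pq: "\<phi> b = Fin p" "\<phi> c = Fin q" "p \<noteq> q"
    by (metis ext_complex.exhaust)
  define m where "m = 1 / (q - p)"
  have "m \<noteq> 0" using pq by (simp add: m_def)
  from sphere_auto_comp[OF sphere_auto_ext_affine[OF this, of "- m * p"] 1(1)]
  have 2: "sphere_auto (ext_affine m (- m * p) \<circ> \<phi>) (\<psi> \<circ> ext_affine (1 / m) (- (- m * p) / m))" .
  have "m * q - m * p = 1"
    using pq by (simp add: m_def diff_divide_distrib[symmetric])
  then show ?thesis
    by (intro that[OF 2]) (simp_all add: 1 pq)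
qed

section \<open>Analytic maps into the sphere\<close>

lemma sphere_analytic_at_sphere_val:
  assumes f: "f nicely_meromorphic_on A" and z: "z \<in> A"
  shows "sphere_analytic_at (sphere_val f) z"
proof (cases "is_pole f z")
  case False
  then have ana: "f analytic_on {z}"
    using f z nicely_meromorphic_on_imp_analytic_at by blast
  then obtain S where S: "open S" "z \<in> S" "f holomorphic_on S"
    by (auto simp: analytic_at)
  have "\<forall>\<^sub>F w in nhds z. w \<in> S"
    using S by (simp add: eventually_nhds_in_open)
  then have "\<forall>\<^sub>F w in nhds z. sphere_val f w = Fin (f w)"
    by eventually_elim (use S not_is_pole_holomorphic in \<open>auto simp: sphere_val_def\<close>)
  then show ?thesis by (rule sphere_analytic_atI1[OF ana])
next
  case True
  \<comment> \<open>At a pole the reciprocal is the chart. It tends to 0, so it has no pole at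
    \<open>z\<close>, and a nicely meromorphic function is analytic wherever it has no pole.\<close>
  define g where "g = (\<lambda>w. inverse (f w))"
  have "(g \<longlongrightarrow> 0) (at z)"
    unfolding g_def using is_pole_tendsto[OF True] by (simp add: o_def)
  then have "\<not> is_pole g z"
    unfolding is_pole_def using not_tendsto_and_filterlim_at_infinity[of "at z" g 0] by auto
  moreover have "g nicely_meromorphic_on A"
    unfolding g_def by (intro nicely_meromorphic_on_inverse f)
  ultimately have ana: "g analytic_on {z}"
    using z nicely_meromorphic_on_imp_analytic_at by blast
  have "g z = 0"
    using ana \<open>(g \<longlongrightarrow> 0) (at z)\<close> analytic_at_imp_isCont[OF ana]
    by (meson LIM_unique isCont_def)
  have "isolated_singularity_at f z"
    using f z unfolding nicely_meromorphic_on_def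
    by (blast intro: meromorphic_on_isolated_singularity meromorphic_on_subset)
  then have "\<forall>\<^sub>F w in at z. f analytic_on {w}"
    by (simp add: isolated_singularity_at_altdef)
  moreover have "\<forall>\<^sub>F w in at z. f w \<noteq> 0"
    using True by (rule non_zero_neighbour_pole)
  ultimately have "\<forall>\<^sub>F w in at z. sphere_val f w = ext_inv (Fin (g w))"
    by eventually_elim (auto simp: sphere_val_def g_def inverse_eq_divide analytic_at_imp_no_pole)
  moreover have "sphere_val f z = ext_inv (Fin (g z))"
    using True \<open>g z = 0\<close> by (simp add: sphere_val_def)
  ultimately have "\<forall>\<^sub>F w in nhds z. sphere_val f w = ext_inv (Fin (g w))"
    by (simp add: eventually_nhds_conv_at)
  then show ?thesis by (rule sphere_analytic_atI2[OF ana])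
qed

lemma dist_Fin_le: "dist (Fin z) (Fin w) \<le> 2 * dist z w"
proof -
  have "2 * cmod (z - w) \<le> 2 * cmod (z - w) * (sqrt (1 + (cmod z)\<^sup>2) * sqrt (1 + (cmod w)\<^sup>2))"
    using mult_mono[of 1 "sqrt (1 + (cmod z)\<^sup>2)" 1 "sqrt (1 + (cmod w)\<^sup>2)"]
    by (intro mult_le_cancel_left1[THEN iffD2]) auto
  then show ?thesis
    using one_plus_cmod_sq_pos[of z] one_plus_cmod_sq_pos[of w]
    by (simp add: dist_Fin_Fin dist_norm pos_divide_le_eq)
qed

lemma uniformly_continuous_Fin: "uniformly_continuous_on UNIV Fin"
  unfolding uniformly_continuous_on_def
proof safe
  fix e :: real assume "e > 0"
  show "\<exists>d>0. \<forall>x\<in>UNIV. \<forall>x'\<in>UNIV. dist x' x < d \<longrightarrow> dist (Fin x') (Fin x) < e"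
  proof (intro exI[of _ "e / 2"] conjI ballI impI)
    fix x x' :: complex assume "dist x' x < e / 2"
    then show "dist (Fin x') (Fin x) < e" using dist_Fin_le[of x' x] by simp
  qed (use \<open>e > 0\<close> in simp)
qed

lemma sphere_mapD:
  assumes "sphere_map \<phi>"
  shows "uniformly_continuous_on UNIV \<phi>" "isCont \<phi> x"
    "sphere_analytic_at F z \<Longrightarrow> sphere_analytic_at (\<lambda>w. \<phi> (F w)) z"
proof -
  show 1: "uniformly_continuous_on UNIV \<phi>"
    using assms by (simp add: sphere_map_def)
  show "isCont \<phi> x"
    using uniformly_continuous_imp_continuous[OF 1] by (simp add: continuous_on_eq_continuous_at)
  show "sphere_analytic_at F z \<Longrightarrow> sphere_analytic_at (\<lambda>w. \<phi> (F w)) z"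
    using assms by (simp add: sphere_map_def)
qed

lemma sphere_analytic_at_imp_isCont:
  assumes "sphere_analytic_at F z"
  shows "isCont F z"
proof -
  obtain g where g: "g analytic_on {z}"
    "(\<forall>\<^sub>F w in nhds z. F w = Fin (g w)) \<or> (\<forall>\<^sub>F w in nhds z. F w = ext_inv (Fin (g w)))"
    using assms unfolding sphere_analytic_at_def by blast
  have "isCont Fin (g z)"
    using uniformly_continuous_imp_continuous[OF uniformly_continuous_Fin]
    by (simp add: continuous_on_eq_continuous_at)
  then have 1: "isCont (\<lambda>w. Fin (g w)) z"
    by (intro isCont_o2[OF analytic_at_imp_isCont[OF g(1)]])
  then have 2: "isCont (\<lambda>w. ext_inv (Fin (g w))) z"
    by (rule isCont_o2) (rule sphere_mapD(2)[OF sphere_map_ext_inv])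
  show ?thesis
    using g(2) isCont_cong[of F "\<lambda>w. Fin (g w)" z] isCont_cong[of F "\<lambda>w. ext_inv (Fin (g w))" z] 1 2 by blast
qed

text \<open>The bridge back to complex-valued functions: in the reciprocal chart, finiteness of
  \<open>F z\<close> means \<open>g z \<noteq> 0\<close>, so \<open>1 / g\<close> is analytic at
  \<open>z\<close>.\<close>

lemma sphere_analytic_finite:
  assumes ana: "\<And>z. z \<in> A \<Longrightarrow> sphere_analytic_at F z" and fin: "\<And>z. z \<in> A \<Longrightarrow> F z \<noteq> Infty"
  obtains f where "f analytic_on A" "\<And>z. z \<in> A \<Longrightarrow> F z = Fin (f z)"
proof -
  define f where "f z = (case F z of Fin w \<Rightarrow> w | Infty \<Rightarrow> 0)" for z
  have "f analytic_on {z}" if z: "z \<in> A" for z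
  proof -
    obtain g where g: "g analytic_on {z}"
      "(\<forall>\<^sub>F w in nhds z. F w = Fin (g w)) \<or> (\<forall>\<^sub>F w in nhds z. F w = ext_inv (Fin (g w)))"
      using ana[OF z] unfolding sphere_analytic_at_def by blast
    show ?thesis
      using g(2)
    proof
      assume "\<forall>\<^sub>F w in nhds z. F w = Fin (g w)"
      then have "\<forall>\<^sub>F w in nhds z. f w = g w"
        by eventually_elim (simp add: f_def)
      then show ?thesis using g(1) analytic_at_cong[of f g z z] by simp
    next
      assume F: "\<forall>\<^sub>F w in nhds z. F w = ext_inv (Fin (g w))"
      then have "F z = ext_inv (Fin (g z))" by (rule eventually_nhds_x_imp_x)
      with fin[OF z] have gz: "g z \<noteq> 0" by auto
      then have "\<forall>\<^sub>F w in nhds z. g w \<noteq> 0" by (rule eventually_nonzero_nhds[OF g(1)])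
      with F have "\<forall>\<^sub>F w in nhds z. f w = 1 / g w"
        by eventually_elim (simp add: f_def)
      moreover have "(\<lambda>w. 1 / g w) analytic_on {z}"
        using gz by (auto intro!: analytic_intros g(1))
      ultimately show ?thesis using analytic_at_cong[of f "\<lambda>w. 1 / g w" z z] by simp
    qed
  qed
  then have "f analytic_on A" using analytic_on_analytic_at by blast
  moreover have "F z = Fin (f z)" if "z \<in> A" for z
    using fin[OF that] by (cases "F z") (auto simp: f_def)
  ultimately show ?thesis using that by blast
qed

section \<open>Uniform limits and isolated values of analytic maps into the sphere\<close>

lemma dist_Fin_0: "dist (Fin z) (Fin 0) = 2 * cmod z / sqrt (1 + (cmod z)\<^sup>2)"
  by (simp add: dist_Fin_Fin)

lemma near_zero_imp_cmod_le_1: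
  assumes "dist x (Fin 0) \<le> 1"
  obtains z where "x = Fin z" "cmod z \<le> 1"
proof (cases x)
  case (Fin z)
  have "2 * cmod z \<le> sqrt (1 + (cmod z)\<^sup>2)"
    using assms one_plus_cmod_sq_pos[of z] by (simp add: Fin dist_Fin_0 pos_divide_le_eq)
  then have "(2 * cmod z)\<^sup>2 \<le> 1 + (cmod z)\<^sup>2"
    using real_le_rsqrt real_sqrt_ge_abs1 by (smt (verit) norm_ge_zero one_plus_cmod_sq_pos power2_le_iff_abs_le real_sqrt_pow2)
  then have "(cmod z)\<^sup>2 \<le> 1\<^sup>2" by (simp add: power_mult_distrib)
  then have "cmod z \<le> 1" by (rule power2_le_imp_le) simp
  then show ?thesis using that Fin by blast
next
  case Infty
  then show ?thesis using assms dist_Fin_Infty[of 0] by (simp add: dist_commute)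
qed

text \<open>In the closed unit disc both weights are at most \<open>sqrt 2\<close>, which is
  balanced by the factor 2 of the chordal metric. Chordal convergence there yields Euclidean
  convergence.\<close>

lemma dist_le_dist_Fin:
  assumes "cmod z \<le> 1" "cmod w \<le> 1"
  shows "dist z w \<le> dist (Fin z) (Fin w)"
proof -
  have "sqrt (1 + (cmod z)\<^sup>2) * sqrt (1 + (cmod w)\<^sup>2) \<le> sqrt 2 * sqrt 2"
    using assms by (intro mult_mono real_sqrt_le_mono) (auto simp: power_le_one)
  then have "dist z w * (sqrt (1 + (cmod z)\<^sup>2) * sqrt (1 + (cmod w)\<^sup>2)) \<le> dist z w * 2"
    by (intro mult_left_mono) auto
  then show ?thesis
    using one_plus_cmod_sq_pos[of z] one_plus_cmod_sq_pos[of w]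
    by (simp add: dist_Fin_Fin dist_norm pos_le_divide_eq)
qed

lemma sphere_auto_ex_zero:
  obtains \<phi> \<psi> where "sphere_auto \<phi> \<psi>" "\<phi> a = Fin 0"
proof -
  obtain \<phi> \<psi> where 1: "sphere_auto \<phi> \<psi>" "\<phi> a = Infty"
    using sphere_auto_ex_Infty by blast
  show ?thesis
    by (rule that[OF sphere_auto_comp[OF sphere_auto_ext_inv 1(1)]]) (simp add: 1)
qed

text \<open>Weierstrass' theorem on the sphere. After \<open>h z0\<close> is moved to 0, continuity
  of the limit and uniform convergence force almost all functions into the unit disc on a small
  ball, where the classical theorem applies; the inverse automorphism returns to \<open>h\<close>. A
  limit identically \<open>Infty\<close> is included.\<close>

lemma sphere_analytic_at_uniform_limit:
  assumes U: "open U" "z0 \<in> U"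
    and ana: "\<And>n z. z \<in> U \<Longrightarrow> sphere_analytic_at (G n) z"
    and lim: "uniform_limit U G h sequentially"
  shows "sphere_analytic_at h z0"
proof -
  obtain \<phi> \<psi> where \<phi>: "sphere_auto \<phi> \<psi>" "\<phi> (h z0) = Fin 0"
    by (rule sphere_auto_ex_zero)
  then have maps: "sphere_map \<phi>" "sphere_map \<psi>" and \<psi>: "\<And>x. \<psi> (\<phi> x) = x"
    by (auto simp: sphere_auto_def)
  define H where "H = (\<lambda>z. \<phi> (h z))"
  define K where "K n = (\<lambda>z. \<phi> (G n z))" for n
  have K: "sphere_analytic_at (K n) z" if "z \<in> U" for n z
    unfolding K_def by (rule sphere_mapD(3)[OF maps(1) ana[OF that]])
  have limK: "uniform_limit U K H sequentially"
    unfolding K_def H_def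
    by (rule uniform_limit_compose_uniformly_continuous_on[OF lim sphere_mapD(1)[OF maps(1)]]) auto
  have "continuous_on U (K n)" for n
    using K sphere_analytic_at_imp_isCont continuous_at_imp_continuous_on by blast
  then have "continuous_on U H"
    by (intro uniform_limit_theorem[OF _ limK]) auto
  then have "isCont H z0"
    using U continuous_on_eq_continuous_at by blast
  then have "\<forall>\<^sub>F z in nhds z0. dist (H z) (H z0) < 1 / 2"
    unfolding isCont_def tendsto_at_iff_tendsto_nhds by (intro tendstoD) auto
  moreover have "\<forall>\<^sub>F z in nhds z0. z \<in> U"
    using U by (simp add: eventually_nhds_in_open)
  ultimately have "\<forall>\<^sub>F z in nhds z0. z \<in> U \<and> dist (H z) (Fin 0) < 1 / 2"
    by eventually_elim (use \<phi>(2) in \<open>auto simp: H_def\<close>)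
  then obtain r where "r > 0" and r: "\<And>z. dist z z0 \<le> r \<Longrightarrow> z \<in> U \<and> dist (H z) (Fin 0) < 1 / 2"
    unfolding eventually_nhds_metric_le by blast
  define B where "B = cball z0 r"
  have B: "B \<subseteq> U" "\<And>z. z \<in> B \<Longrightarrow> dist (H z) (Fin 0) < 1 / 2"
    using r by (auto simp: B_def dist_commute)
  have limB: "uniform_limit B K H sequentially"
    by (rule uniform_limit_on_subset[OF limK B(1)])
  then have "\<forall>\<^sub>F n in sequentially. \<forall>z\<in>B. dist (K n z) (H z) < 1 / 2"
    by (rule uniform_limitD) simp
  then obtain N where N: "\<And>n z. n \<ge> N \<Longrightarrow> z \<in> B \<Longrightarrow> dist (K n z) (H z) < 1 / 2"
    unfolding eventually_sequentially by blast
  have K0: "dist (K n z) (Fin 0) \<le> 1" if "n \<ge> N" "z \<in> B" for n z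
    using N[OF that] B(2)[OF that(2)] dist_triangle[of "K n z" "Fin 0" "H z"] by linarith
  have "\<exists>f. f analytic_on B \<and> (\<forall>z\<in>B. K n z = Fin (f z))" if "n \<ge> N" for n
  proof -
    have "K n z \<noteq> Infty" if "z \<in> B" for z
      using K0[OF \<open>n \<ge> N\<close> that] dist_Fin_Infty[of 0] by (auto simp: dist_commute)
    then show ?thesis
      using sphere_analytic_finite[of B "K n"] K B(1) by (metis subsetD)
  qed
  then obtain k where k: "\<And>n. n \<ge> N \<Longrightarrow> k n analytic_on B"
    "\<And>n z. n \<ge> N \<Longrightarrow> z \<in> B \<Longrightarrow> K n z = Fin (k n z)"
    by metis
  have "\<exists>w. H z = Fin w \<and> cmod w \<le> 1" if "z \<in> B" for z
    using near_zero_imp_cmod_le_1[of "H z"] B(2)[OF that] by fastforce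
  then obtain g where g: "\<And>z. z \<in> B \<Longrightarrow> H z = Fin (g z)" "\<And>z. z \<in> B \<Longrightarrow> cmod (g z) \<le> 1"
    by metis
  have k1: "cmod (k n z) \<le> 1" if "n \<ge> N" "z \<in> B" for n z
    using near_zero_imp_cmod_le_1[OF K0[OF that]] k(2)[OF that] by (metis ext_complex.inject)
  have "uniform_limit B k g sequentially"
  proof (rule uniform_limitI)
    fix e :: real assume "e > 0"
    have "\<forall>\<^sub>F n in sequentially. \<forall>z\<in>B. dist (K n z) (H z) < e"
      using limB \<open>e > 0\<close> by (rule uniform_limitD)
    then show "\<forall>\<^sub>F n in sequentially. \<forall>z\<in>B. dist (k n z) (g z) < e"
      using eventually_ge_at_top[of N]
    proof eventually_elim
      case (elim n)
      have "dist (k n z) (g z) \<le> dist (K n z) (H z)" if "z \<in> B" for z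
        using dist_le_dist_Fin[OF k1[OF elim(2) that] g(2)[OF that]]
        by (simp only: k(2)[OF elim(2) that] g(1)[OF that])
      with elim(1) show ?case by (blast intro: le_less_trans)
    qed
  qed
  moreover have "\<forall>\<^sub>F n in sequentially. continuous_on (cball z0 r) (k n) \<and> k n holomorphic_on ball z0 r"
    using eventually_ge_at_top[of N]
  proof eventually_elim
    case (elim n)
    have "k n holomorphic_on cball z0 r"
      using k(1)[OF elim] analytic_imp_holomorphic by (simp add: B_def)
    then show ?case
      using ball_subset_cball holomorphic_on_imp_continuous_on holomorphic_on_subset by blast
  qed
  ultimately have "g holomorphic_on ball z0 r"
    unfolding B_def using holomorphic_uniform_limit by (metis trivial_limit_sequentially)
  then have "g analytic_on {z0}"
    using \<open>r > 0\<close> by (auto simp: analytic_at intro!: exI[of _ "ball z0 r"])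
  moreover have "\<forall>\<^sub>F z in nhds z0. z \<in> ball z0 r"
    using \<open>r > 0\<close> by (intro eventually_nhds_in_open) auto
  then have "\<forall>\<^sub>F z in nhds z0. H z = Fin (g z)"
    by eventually_elim (auto simp: g(1) B_def)
  ultimately have "sphere_analytic_at H z0"
    by (rule sphere_analytic_atI1)
  from sphere_mapD(3)[OF maps(2) this] show ?thesis
    by (simp add: H_def \<psi>)
qed

text \<open>With \<open>a\<close> moved to 0, the \<open>a\<close>-points become zeros of an
  analytic function, which are isolated or fill a neighbourhood.\<close>

lemma sphere_analytic_at_isolated_values:
  assumes "sphere_analytic_at h z0"
  shows "(\<forall>\<^sub>F w in nhds z0. h w = a) \<or> (\<forall>\<^sub>F w in at z0. h w \<noteq> a)"
proof -
  obtain \<phi> \<psi> where \<phi>: "sphere_auto \<phi> \<psi>" "\<phi> a = Fin 0"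
    by (rule sphere_auto_ex_zero)
  then have "sphere_map \<phi>" by (simp add: sphere_auto_def)
  have a: "h w = a \<longleftrightarrow> \<phi> (h w) = Fin 0" for w
    using \<phi> sphere_auto_inj by metis
  have "sphere_analytic_at (\<lambda>w. \<phi> (h w)) z0"
    by (rule sphere_mapD(3)[OF \<open>sphere_map \<phi>\<close> assms])
  then obtain g where g: "g analytic_on {z0}"
    "(\<forall>\<^sub>F w in nhds z0. \<phi> (h w) = Fin (g w)) \<or> (\<forall>\<^sub>F w in nhds z0. \<phi> (h w) = ext_inv (Fin (g w)))"
    unfolding sphere_analytic_at_def by blast
  show ?thesis
    using g(2)
  proof
    assume ev: "\<forall>\<^sub>F w in nhds z0. \<phi> (h w) = Fin (g w)"
    then have ev': "\<forall>\<^sub>F w in at z0. \<phi> (h w) = Fin (g w)"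
      by (simp add: eventually_nhds_conv_at)
    consider "g z0 \<noteq> 0" | "isolated_zero g z0" | "g z0 = 0" "\<forall>\<^sub>F w in at z0. g w = 0"
      using non_isolated_zero_imp_eventually_zero[OF g(1)] by blast
    then show ?thesis
    proof cases
      case 1
      then have "\<forall>\<^sub>F w in at z0. g w \<noteq> 0"
        using eventually_nonzero_nhds[OF g(1)] by (simp add: eventually_nhds_conv_at)
      with ev' have "\<forall>\<^sub>F w in at z0. h w \<noteq> a"
        by eventually_elim (simp add: a)
      then show ?thesis ..
    next
      case 2
      then have "\<forall>\<^sub>F w in at z0. g w \<noteq> 0"
        by (simp add: isolated_zero_def)
      with ev' have "\<forall>\<^sub>F w in at z0. h w \<noteq> a"
        by eventually_elim (simp add: a)
      then show ?thesis ..
    next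
      case 3
      then have "\<forall>\<^sub>F w in nhds z0. g w = 0"
        by (simp add: eventually_nhds_conv_at)
      with ev have "\<forall>\<^sub>F w in nhds z0. h w = a"
        by eventually_elim (simp add: a)
      then show ?thesis ..
    qed
  next
    \<comment> \<open>In the reciprocal chart the value is \<open>Infty\<close> or a nonzero
      reciprocal, never 0.\<close>
    assume "\<forall>\<^sub>F w in nhds z0. \<phi> (h w) = ext_inv (Fin (g w))"
    then have "\<forall>\<^sub>F w in nhds z0. h w \<noteq> a"
      by eventually_elim (simp add: a)
    then show ?thesis
      by (simp add: eventually_nhds_conv_at)
  qed
qed

lemma sphere_analytic_identity:
  assumes D: "open D" "connected D"
    and ana: "\<And>z. z \<in> D \<Longrightarrow> sphere_analytic_at h z"
    and nonconst: "\<not> h constant_on D"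
    and z: "z \<in> D"
  shows "\<forall>\<^sub>F w in at z. h w \<noteq> a"
proof (rule ccontr)
  assume neg: "\<not> ?thesis"
  define S where "S = {z \<in> D. \<forall>\<^sub>F w in nhds z. h w = a}"
  have "z \<in> S"
    using neg sphere_analytic_at_isolated_values[OF ana[OF z]] z by (auto simp: S_def)
  have "S = D"
  \<comment> \<open>\<open>GPicard2\<close> is the connectedness criterion: a nonempty open subset
    containing its limit points in \<open>D\<close> is all of \<open>D\<close>. At such a limit
    point \<open>a\<close> is taken frequently, so of the local dichotomy only the constant case
    remains.\<close>
  proof (rule GPicard2)
    show "S \<noteq> {}" using \<open>z \<in> S\<close> by auto
    have "S = D \<inter> interior {w. h w = a}"
      by (auto simp: S_def eventually_nhds interior_def)
    then show "open S" using D by auto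
    fix x assume x: "x islimpt S" "x \<in> D"
    have "\<exists>\<^sub>F w in at x. w \<in> S"
      using x(1) by (simp add: islimpt_conv_frequently_at)
    then have "\<exists>\<^sub>F w in at x. h w = a"
      by (rule frequently_elim1) (auto simp: S_def dest: eventually_nhds_x_imp_x)
    then show "x \<in> S"
      using sphere_analytic_at_isolated_values[OF ana[OF x(2)], of a] x(2)
      by (auto simp: S_def frequently_def)
  qed (use D in \<open>auto simp: S_def\<close>)
  then have "h w = a" if "w \<in> D" for w
    using that eventually_nhds_x_imp_x by (fastforce simp: S_def)
  then show False using nonconst by (auto simp: constant_on_def)
qed

section \<open>Normality\<close>

text \<open>Convergence is asked for within every subsequence because each diagonal stage refines
  the earlier ones; Lindelof's theorem leaves countably many stages.\<close>

lemma diagonal_loc_uniform_limit: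
  fixes fs :: "nat \<Rightarrow> complex \<Rightarrow> ext_complex"
  assumes "D \<noteq> {}"
    and loc: "\<And>z. z \<in> D \<Longrightarrow> \<exists>U. open U \<and> z \<in> U \<and> U \<subseteq> D \<and>
      (\<forall>s :: nat \<Rightarrow> nat. strict_mono s \<longrightarrow> (\<exists>r h. strict_mono (r :: nat \<Rightarrow> nat) \<and> uniform_limit U (\<lambda>n. fs (s (r n))) h sequentially))"
  obtains r h where "strict_mono (r :: nat \<Rightarrow> nat)" "loc_uniform_limit D (\<lambda>n. fs (r n)) h"
proof -
  define Q where "Q U \<longleftrightarrow> (\<forall>s :: nat \<Rightarrow> nat. strict_mono s \<longrightarrow>
      (\<exists>r h. strict_mono (r :: nat \<Rightarrow> nat) \<and> uniform_limit U (\<lambda>n. fs (s (r n))) h sequentially))" for U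
  have "\<forall>z\<in>D. \<exists>U. open U \<and> z \<in> U \<and> U \<subseteq> D \<and> Q U"
    unfolding Q_def by (intro ballI loc)
  then obtain U where U: "\<And>z. z \<in> D \<Longrightarrow> open (U z)" "\<And>z. z \<in> D \<Longrightarrow> z \<in> U z"
    "\<And>z. z \<in> D \<Longrightarrow> U z \<subseteq> D" "\<And>z. z \<in> D \<Longrightarrow> Q (U z)"
    by metis
  obtain \<U> where \<U>: "\<U> \<subseteq> U ` D" "countable \<U>" "\<Union>\<U> = \<Union>(U ` D)"
    by (rule Lindelof[of "U ` D"]) (use U in auto)
  have "\<U> \<noteq> {}" using \<U>(3) \<open>D \<noteq> {}\<close> U(2) by auto
  define V where "V = from_nat_into \<U>"
  have rangeV: "range V = \<U>"
    unfolding V_def using \<open>\<U> \<noteq> {}\<close> \<U>(2) by (rule range_from_nat_into)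
  define P where "P n r \<longleftrightarrow> (\<exists>h. uniform_limit (V n) (\<lambda>k. fs (r k)) h sequentially)" for n and r :: "nat \<Rightarrow> nat"
  interpret subseqs P
  proof
    fix n and s :: "nat \<Rightarrow> nat" assume "strict_mono s"
    have "V n \<in> U ` D" using rangeV \<U>(1) by blast
    then have "Q (V n)" using U(4) by auto
    then show "\<exists>r'. strict_mono r' \<and> P n (s \<circ> r')"
      using \<open>strict_mono s\<close> unfolding P_def Q_def by simp
  qed
  \<comment> \<open>Only the tail after index \<open>k\<close> is known to refine stage
    \<open>k\<close>, hence the shift by \<open>Suc k\<close>. It is removed afterwards, since a
    limit ignores finitely many terms.\<close>
  have diag: "P k (diagseq \<circ> ((+) (Suc k)))" for k
  proof (rule diagseq_holds)
    fix r s :: "nat \<Rightarrow> nat" and n assume "strict_mono r" "P n s"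
    then show "P n (s \<circ> r)"
      unfolding P_def o_def using filterlim_compose[OF _ filterlim_subseq] by blast
  qed
  have "\<exists>h. uniform_limit (V k) (\<lambda>n. fs (diagseq (n + Suc k))) h sequentially" for k
    using diag[of k] by (simp add: P_def add.commute)
  moreover have "uniform_limit (V k) (\<lambda>n. fs (diagseq n)) h sequentially"
    if "uniform_limit (V k) (\<lambda>n. fs (diagseq (n + Suc k))) h sequentially" for h k
  proof (rule uniform_limitI)
    fix e :: real assume "e > 0"
    with that have "\<forall>\<^sub>F n in sequentially. \<forall>x\<in>V k. dist (fs (diagseq (n + Suc k)) x) (h x) < e"
      by (rule uniform_limitD)
    then show "\<forall>\<^sub>F n in sequentially. \<forall>x\<in>V k. dist (fs (diagseq n) x) (h x) < e"
      by (rule eventually_sequentially_seg[where P = "\<lambda>n. \<forall>x\<in>V k. dist (fs (diagseq n) x) (h x) < e", THEN iffD1])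
  qed
  ultimately have "\<exists>h. uniform_limit (V k) (\<lambda>n. fs (diagseq n)) h sequentially" for k
    by meson
  then obtain h where h: "\<And>k. uniform_limit (V k) (\<lambda>n. fs (diagseq n)) (h k) sequentially"
    by metis
  \<comment> \<open>The limits on overlapping sets agree, being pointwise limits of the same
    sequence, so \<open>lim\<close> glues them.\<close>
  define H where "H z = lim (\<lambda>n. fs (diagseq n) z)" for z
  have "H z = h k z" if "z \<in> V k" for k z
    unfolding H_def by (rule limI) (rule tendsto_uniform_limitI[OF h that])
  then have limH: "uniform_limit (V k) (\<lambda>n. fs (diagseq n)) H sequentially" for k
    using h[of k] by (simp cong: uniform_limit_cong')
  have "loc_uniform_limit D (\<lambda>n. fs (diagseq n)) H"
    unfolding loc_uniform_limit_def
  proof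
    fix z assume "z \<in> D"
    then have "z \<in> \<Union>\<U>" using U(2) unfolding \<U>(3) by blast
    then obtain k where k: "z \<in> V k" using rangeV by blast
    obtain y where "y \<in> D" "V k = U y" using rangeV \<U>(1) by blast
    then show "\<exists>U. open U \<and> z \<in> U \<and> U \<subseteq> D \<and> uniform_limit U (\<lambda>n. fs (diagseq n)) H sequentially"
      using k limH[of k] U by metis
  qed
  then show ?thesis using that subseq_diagseq by blast
qed

text \<open>Normalising \<open>a\<close>, \<open>b\<close>, \<open>c\<close> to infinity, 0 and 1, either \<open>f\<close> or
  \<open>1 / f\<close> is at most 1 in modulus at a fixed point of the annulus. By Schottky's theorem it is then
  bounded on a circle in the annulus, and by the maximum principle in the disc.\<close>

lemma montel_three_values:
  assumes "R > 0" and abc: "a \<noteq> b" "a \<noteq> c" "b \<noteq> c"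
    and ana: "\<And>n z. z \<in> ball z0 R \<Longrightarrow> sphere_analytic_at (F n) z"
    and omit: "\<And>n z. z \<in> ball z0 R \<Longrightarrow> F n z \<noteq> a" "\<And>n z. z \<in> ball z0 R \<Longrightarrow> F n z \<noteq> b"
      "\<And>n z. z \<in> ball z0 R \<Longrightarrow> R / 2 < dist z0 z \<Longrightarrow> F n z \<noteq> c"
  obtains r h where "strict_mono (r :: nat \<Rightarrow> nat)"
    "uniform_limit (ball z0 (R / 2)) (\<lambda>n. F (r n)) h sequentially"
proof -
  obtain \<phi> \<psi> where \<phi>: "sphere_auto \<phi> \<psi>" "\<phi> a = Infty" "\<phi> b = Fin 0" "\<phi> c = Fin 1"
    by (rule sphere_auto_ex[OF abc])
  then have maps: "sphere_map \<phi>" "sphere_map \<psi>" and \<psi>: "\<And>x. \<psi> (\<phi> x) = x"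
    by (auto simp: sphere_auto_def)
  have "\<exists>f. f analytic_on ball z0 R \<and> (\<forall>z\<in>ball z0 R. \<phi> (F n z) = Fin (f z))" for n
  proof -
    have "\<phi> (F n z) \<noteq> Infty" if "z \<in> ball z0 R" for z
      using omit(1)[OF that] \<phi>(2) sphere_auto_inj[OF \<phi>(1)] by metis
    then show ?thesis
      using sphere_analytic_finite[of "ball z0 R" "\<lambda>z. \<phi> (F n z)"] sphere_mapD(3)[OF maps(1)] ana
      by metis
  qed
  then obtain f where f: "\<And>n. f n analytic_on ball z0 R" "\<And>n z. z \<in> ball z0 R \<Longrightarrow> \<phi> (F n z) = Fin (f n z)"
    by metis
  have f0: "f n z \<noteq> 0" if "z \<in> ball z0 R" for n z
    using omit(2)[OF that] f(2)[OF that] \<phi>(3) sphere_auto_inj[OF \<phi>(1)] by metis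
  have f1: "f n z \<noteq> 1" if "z \<in> ball z0 R" "R / 2 < dist z0 z" for n z
    using omit(3)[OF that] f(2)[OF that(1)] \<phi>(4) sphere_auto_inj[OF \<phi>(1)] by metis
  have fhol: "f n holomorphic_on ball z0 R" for n
    by (rule analytic_imp_holomorphic[OF f(1)])
  define A where "A = {z. R / 2 < norm (z - z0) \<and> norm (z - z0) < R}"
  have A: "z \<in> ball z0 R \<and> R / 2 < dist z0 z" if "z \<in> A" for z
    using that by (simp add: A_def dist_norm norm_minus_commute)
  \<comment> \<open>The circle midway through the annulus: compact in \<open>A\<close>, and its disc
    contains \<open>cball z0 (R / 2)\<close>.\<close>
  define K where "K = sphere z0 (3 * R / 4)"
  define w where "w = z0 + of_real (3 * R / 4)"
  \<comment> \<open>The choice gives \<open>cmod (g n w) \<le> 1\<close>, the normalisation for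
    Schottky's theorem; taking reciprocals preserves the omission of 0 and 1.\<close>
  define g where "g n = (if cmod (f n w) \<le> 1 then f n else (\<lambda>z. 1 / f n z))" for n
  have ghol: "g n holomorphic_on ball z0 R" for n
    using fhol[of n] f0[of _ n] by (auto simp: g_def intro!: holomorphic_intros)
  define X where "X = {h. h holomorphic_on A \<and> (\<forall>z\<in>A. h z \<noteq> 0 \<and> h z \<noteq> 1)}"
  define Y where "Y = {h \<in> X. cmod (h w) \<le> 1}"
  have "A = ball z0 R - cball z0 (R / 2)"
    by (auto simp: A_def dist_norm norm_minus_commute)
  then have "open A" by (simp add: open_Diff)
  have "connected A"
    unfolding A_def by (rule connected_annulus(1)) simp
  have "w \<in> A" "K \<subseteq> A"
    using \<open>R > 0\<close> by (auto simp: A_def w_def K_def dist_norm norm_minus_commute)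
  have gY: "g n \<in> Y" for n
  proof -
    have "g n holomorphic_on A"
      using ghol A holomorphic_on_subset by blast
    moreover have "g n z \<noteq> 0 \<and> g n z \<noteq> 1" if "z \<in> A" for z
      using f0[of z n] f1[of z n] A[OF that] by (auto simp: g_def)
    moreover have "cmod (g n w) \<le> 1"
      by (simp add: g_def norm_divide divide_le_eq_1)
    ultimately show ?thesis by (simp add: Y_def X_def)
  qed
  obtain M where M: "\<And>h z. h \<in> Y \<Longrightarrow> z \<in> K \<Longrightarrow> cmod (h z) \<le> M"
  proof (rule GPicard3[OF \<open>open A\<close> \<open>connected A\<close> \<open>w \<in> A\<close>, of Y X K])
    show "Y \<subseteq> X" "compact K" "K \<subseteq> A" using \<open>K \<subseteq> A\<close> by (auto simp: Y_def K_def)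
  qed (auto simp: X_def Y_def)
  have bound: "cmod (g n z) \<le> M" if "z \<in> ball z0 (3 * R / 4)" for n z
  proof (rule maximum_modulus_frontier[of "g n" "ball z0 (3 * R / 4)"])
    show "g n holomorphic_on interior (ball z0 (3 * R / 4))"
      by (rule holomorphic_on_subset[OF ghol]) (use \<open>R > 0\<close> in auto)
    have "cball z0 (3 * R / 4) \<subseteq> ball z0 R" using \<open>R > 0\<close> by auto
    then show "continuous_on (closure (ball z0 (3 * R / 4))) (g n)"
      using ghol[of n] \<open>R > 0\<close> by (auto intro: holomorphic_on_imp_continuous_on holomorphic_on_subset)
    show "cmod (g n \<zeta>) \<le> M" if "\<zeta> \<in> frontier (ball z0 (3 * R / 4))" for \<zeta>
      using that M[OF gY] \<open>R > 0\<close> by (simp add: K_def)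
  qed (use that in auto)
  obtain k r where kr: "strict_mono (r :: nat \<Rightarrow> nat)"
    "\<And>C. compact C \<Longrightarrow> C \<subseteq> ball z0 (3 * R / 4) \<Longrightarrow> uniform_limit C (g \<circ> r) k sequentially"
  proof (rule Montel[of "ball z0 (3 * R / 4)" "range g" g])
    show "h holomorphic_on ball z0 (3 * R / 4)" if "h \<in> range g" for h
      using that \<open>R > 0\<close> by (auto intro!: holomorphic_on_subset[OF ghol])
    show "\<exists>B. \<forall>h\<in>range g. \<forall>z\<in>C. cmod (h z) \<le> B" if "C \<subseteq> ball z0 (3 * R / 4)" for C
      using bound that by blast
  qed auto
  have lim: "uniform_limit (cball z0 (R / 2)) (g \<circ> r) k sequentially"
    by (rule kr(2)) (use \<open>R > 0\<close> in auto)
  have lim': "uniform_limit (ball z0 (R / 2)) (\<lambda>n. g (r (q n))) k sequentially"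
    if "strict_mono q" for q
    using filterlim_compose[OF uniform_limit_on_subset[OF lim ball_subset_cball] filterlim_subseq[OF that]]
    by (simp add: o_def)
  have limFin: "uniform_limit (ball z0 (R / 2)) (\<lambda>n z. Fin (g (r (q n)) z)) (\<lambda>z. Fin (k z)) sequentially"
    if "strict_mono q" for q
    by (rule uniform_limit_compose_uniformly_continuous_on[OF lim'[OF that] uniformly_continuous_Fin]) auto
  show ?thesis
  \<comment> \<open>Whether \<open>g n\<close> is \<open>f n\<close> or its reciprocal varies with
    \<open>n\<close>, but one of the two choices occurs infinitely often along
    \<open>r\<close>.\<close>
  proof (cases "infinite {n. cmod (f (r n) w) \<le> 1}")
    case True
    then obtain q where q: "strict_mono (q :: nat \<Rightarrow> nat)" "\<And>n. cmod (f (r (q n)) w) \<le> 1"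
      using infinite_enumerate by blast
    have "uniform_limit (ball z0 (R / 2)) (\<lambda>n z. \<psi> (Fin (g (r (q n)) z))) (\<lambda>z. \<psi> (Fin (k z))) sequentially"
      by (rule uniform_limit_compose_uniformly_continuous_on[OF limFin[OF q(1)] sphere_mapD(1)[OF maps(2)]]) auto
    also have "?this \<longleftrightarrow> uniform_limit (ball z0 (R / 2)) (\<lambda>n. F ((r \<circ> q) n)) (\<lambda>z. \<psi> (Fin (k z))) sequentially"
    proof (intro uniform_limit_cong' refl)
      fix n z assume "z \<in> ball z0 (R / 2)"
      then have "z \<in> ball z0 R" using \<open>R > 0\<close> by auto
      then show "\<psi> (Fin (g (r (q n)) z)) = F ((r \<circ> q) n) z"
        using f(2) \<psi> q(2) by (metis g_def o_apply)
    qed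
    finally show ?thesis
      using that[of "r \<circ> q"] kr(1) q(1) strict_mono_o by blast
  next
    case False
    have "{n. \<not> cmod (f (r n) w) \<le> 1} = UNIV - {n. cmod (f (r n) w) \<le> 1}" by auto
    with False have "infinite {n. \<not> cmod (f (r n) w) \<le> 1}"
      using Diff_infinite_finite by (metis infinite_UNIV_nat)
    then obtain q where q: "strict_mono (q :: nat \<Rightarrow> nat)" "\<And>n. \<not> cmod (f (r (q n)) w) \<le> 1"
      using infinite_enumerate by blast
    \<comment> \<open>The reciprocal is undone on the sphere, where inversion is uniformly
      continuous, so zeros of \<open>k\<close> cause no trouble.\<close>
    define \<psi>' where "\<psi>' = \<psi> \<circ> ext_inv"
    have "sphere_map \<psi>'"
      unfolding \<psi>'_def by (intro sphere_map_comp maps sphere_map_ext_inv)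
    then have "uniform_limit (ball z0 (R / 2)) (\<lambda>n z. \<psi>' (Fin (g (r (q n)) z))) (\<lambda>z. \<psi>' (Fin (k z))) sequentially"
      by (intro uniform_limit_compose_uniformly_continuous_on[OF limFin[OF q(1)] sphere_mapD(1)]) auto
    also have "?this \<longleftrightarrow> uniform_limit (ball z0 (R / 2)) (\<lambda>n. F ((r \<circ> q) n)) (\<lambda>z. \<psi>' (Fin (k z))) sequentially"
    proof (intro uniform_limit_cong' refl)
      fix n z assume "z \<in> ball z0 (R / 2)"
      then have z: "z \<in> ball z0 R" using \<open>R > 0\<close> by auto
      have "ext_inv (Fin (g (r (q n)) z)) = Fin (f (r (q n)) z)"
        using q(2)[of n] f0[OF z, of "r (q n)"] by (simp add: g_def)
      then show "\<psi>' (Fin (g (r (q n)) z)) = F ((r \<circ> q) n) z"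
        using f(2)[OF z] \<psi> by (metis \<psi>'_def o_apply)
    qed
    finally show ?thesis
      using that[of "r \<circ> q"] kr(1) q(1) strict_mono_o by blast
  qed
qed

section \<open>Passing omitted values from the limit to the sequence\<close>

lemma uniform_limit_eventually_omits:
  fixes h :: "'a::topological_space \<Rightarrow> 'b::metric_space"
  assumes "compact K" "continuous_on K h" "uniform_limit K G h F" and ne: "\<And>z. z \<in> K \<Longrightarrow> h z \<noteq> a"
  shows "\<forall>\<^sub>F n in F. \<forall>z\<in>K. G n z \<noteq> a"
proof -
  \<comment> \<open>Compactness keeps \<open>h\<close> at a positive distance \<open>d\<close> from
    \<open>a\<close> on all of \<open>K\<close>, so any map uniformly closer than \<open>d\<close>
    to \<open>h\<close> misses \<open>a\<close>.\<close>
  have "closed (h ` K)" using assms compact_continuous_image compact_imp_closed by blast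
  moreover have "a \<notin> h ` K" using ne by auto
  ultimately obtain d where d: "d > 0" "ball a d \<subseteq> - h ` K"
    by (metis Compl_iff openE open_Compl)
  have "\<forall>\<^sub>F n in F. \<forall>z\<in>K. dist (G n z) (h z) < d"
    using assms(3) d(1) by (rule uniform_limitD)
  then show ?thesis
    by eventually_elim (use d(2) in \<open>auto simp: subset_iff\<close>)
qed

text \<open>The hypotheses single out \<open>c\<close> as the one value that \<open>h\<close> may
  take at \<open>z0\<close>. Sharing enters as a pointwise implication, whose contrapositive turns
  omission by \<open>g n\<close> into omission by \<open>f n\<close>.\<close>

lemma partial_sharing_local:
  assumes D: "open D" "z0 \<in> D"
    and abc: "a \<noteq> b" "a \<noteq> c" "b \<noteq> c" "h z0 \<noteq> a" "h z0 \<noteq> b"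
    and f: "\<And>n z. z \<in> D \<Longrightarrow> sphere_analytic_at (f n) z"
    and h: "\<And>z. z \<in> D \<Longrightarrow> isCont h z" "\<forall>\<^sub>F w in at z0. h w \<noteq> c"
    and lim: "loc_uniform_limit D g h"
    and share: "\<And>n z x. z \<in> D \<Longrightarrow> x \<in> {a, b, c} \<Longrightarrow> f n z = x \<Longrightarrow> g n z = x"
  shows "\<exists>U. open U \<and> z0 \<in> U \<and> U \<subseteq> D \<and>
    (\<forall>s :: nat \<Rightarrow> nat. strict_mono s \<longrightarrow> (\<exists>r k. strict_mono (r :: nat \<Rightarrow> nat) \<and> uniform_limit U (\<lambda>n. f (s (r n))) k sequentially))"
proof -
  obtain V where V: "open V" "z0 \<in> V" "V \<subseteq> D" "uniform_limit V g h sequentially"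
    using lim D(2) unfolding loc_uniform_limit_def by blast
  have tend: "(h \<longlongrightarrow> h z0) (nhds z0)"
    using h(1)[OF D(2)] by (simp add: isCont_def tendsto_at_iff_tendsto_nhds)
  have "\<forall>\<^sub>F w in nhds z0. w \<in> V" using V by (simp add: eventually_nhds_in_open)
  moreover have "\<forall>\<^sub>F w in nhds z0. h w \<noteq> a" "\<forall>\<^sub>F w in nhds z0. h w \<noteq> b"
    using tendsto_imp_eventually_ne[OF tend] abc by auto
  moreover have "\<forall>\<^sub>F w in nhds z0. w \<noteq> z0 \<longrightarrow> h w \<noteq> c"
    using h(2) by (simp add: eventually_at_filter)
  ultimately have "\<forall>\<^sub>F w in nhds z0. w \<in> V \<and> h w \<noteq> a \<and> h w \<noteq> b \<and> (w \<noteq> z0 \<longrightarrow> h w \<noteq> c)"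
    by eventually_elim simp
  then obtain R where "R > 0"
    and R: "\<And>w. dist w z0 \<le> R \<Longrightarrow> w \<in> V \<and> h w \<noteq> a \<and> h w \<noteq> b \<and> (w \<noteq> z0 \<longrightarrow> h w \<noteq> c)"
    unfolding eventually_nhds_metric_le by blast
  define B where "B = cball z0 R"
  \<comment> \<open>A compact annulus missing \<open>z0\<close>, the only point of \<open>B\<close>
    where \<open>h\<close> can equal \<open>c\<close>. It contains the open annulus on which
    \<open>montel_three_values\<close> wants \<open>c\<close> omitted.\<close>
  define K where "K = cball z0 R - ball z0 (R / 2)"
  have sub: "B \<subseteq> V" "K \<subseteq> B" using R by (auto simp: B_def K_def dist_commute)
  have cont: "continuous_on B h"
    using h(1) sub V(3) by (intro continuous_at_imp_continuous_on) blast
  have limB: "uniform_limit B g h sequentially"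
    by (rule uniform_limit_on_subset[OF V(4) sub(1)])
  have "\<forall>\<^sub>F n in sequentially. \<forall>z\<in>B. g n z \<noteq> a"
    by (rule uniform_limit_eventually_omits[OF _ cont limB]) (use R in \<open>auto simp: B_def dist_commute\<close>)
  moreover have "\<forall>\<^sub>F n in sequentially. \<forall>z\<in>B. g n z \<noteq> b"
    by (rule uniform_limit_eventually_omits[OF _ cont limB]) (use R in \<open>auto simp: B_def dist_commute\<close>)
  moreover have "\<forall>\<^sub>F n in sequentially. \<forall>z\<in>K. g n z \<noteq> c"
  proof (rule uniform_limit_eventually_omits[OF _ continuous_on_subset[OF cont sub(2)] uniform_limit_on_subset[OF limB sub(2)]])
    show "compact K" by (simp add: K_def compact_diff)
    show "h z \<noteq> c" if "z \<in> K" for z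
      using that R[of z] \<open>R > 0\<close> by (auto simp: K_def dist_commute)
  qed
  ultimately have "\<forall>\<^sub>F n in sequentially. (\<forall>z\<in>B. g n z \<noteq> a) \<and> (\<forall>z\<in>B. g n z \<noteq> b) \<and> (\<forall>z\<in>K. g n z \<noteq> c)"
    by eventually_elim simp
  then obtain N where N: "\<And>n z. n \<ge> N \<Longrightarrow> z \<in> B \<Longrightarrow> g n z \<noteq> a" "\<And>n z. n \<ge> N \<Longrightarrow> z \<in> B \<Longrightarrow> g n z \<noteq> b"
    "\<And>n z. n \<ge> N \<Longrightarrow> z \<in> K \<Longrightarrow> g n z \<noteq> c"
    unfolding eventually_sequentially by blast
  have "\<exists>r k. strict_mono (r :: nat \<Rightarrow> nat) \<and> uniform_limit (ball z0 (R / 2)) (\<lambda>n. f (s (r n))) k sequentially"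
    if s: "strict_mono s" for s :: "nat \<Rightarrow> nat"
  proof -
    \<comment> \<open>The shift by \<open>N\<close> makes every term omit the values, not just
      almost all; \<open>s (n + N) \<ge> N\<close> since a strictly increasing \<open>s\<close>
      dominates the identity.\<close>
    define F where "F n = f (s (n + N))" for n
    have sN: "s (n + N) \<ge> N" for n
      using seq_suble[OF s, of "n + N"] by simp
    have BD: "z \<in> D \<and> z \<in> B" if "z \<in> ball z0 R" for z
      using that sub(1) V(3) ball_subset_cball unfolding B_def by blast
    obtain r k where rk: "strict_mono (r :: nat \<Rightarrow> nat)"
      "uniform_limit (ball z0 (R / 2)) (\<lambda>n. F (r n)) k sequentially"
    proof (rule montel_three_values[OF \<open>R > 0\<close> abc(1-3), of z0 F])
      fix n z assume z: "z \<in> ball z0 R"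
      show "sphere_analytic_at (F n) z" using f BD[OF z] by (simp add: F_def)
      show "F n z \<noteq> a" using N(1)[OF sN] BD[OF z] share[of z a] by (auto simp: F_def)
      show "F n z \<noteq> b" using N(2)[OF sN] BD[OF z] share[of z b] by (auto simp: F_def)
      assume "R / 2 < dist z0 z"
      then have "z \<in> K" using z by (simp add: K_def)
      then show "F n z \<noteq> c" using N(3)[OF sN] BD[OF z] share[of z c] by (auto simp: F_def)
    qed
    have "strict_mono (\<lambda>n. r n + N)" using rk(1) by (simp add: strict_mono_def)
    then show ?thesis using rk(2) unfolding F_def by blast
  qed
  moreover have "ball z0 (R / 2) \<subseteq> D"
    using sub(1) V(3) \<open>R > 0\<close> by (auto simp: B_def subset_iff)
  ultimately show ?thesis
    using \<open>R > 0\<close> by (intro exI[of _ "ball z0 (R / 2)"]) auto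
qed

theorem theorem1p1:
  fixes D :: "complex set"
    and \<F> \<G> :: "(complex \<Rightarrow> complex) set"
    and a\<^sub>1 a\<^sub>2 a\<^sub>3 :: ext_complex
  assumes "open D" "connected D" "D \<noteq> {}"
    and "\<And>f. f \<in> \<F> \<Longrightarrow> f nicely_meromorphic_on D"
    and "\<And>g. g \<in> \<G> \<Longrightarrow> g nicely_meromorphic_on D"
    and "a\<^sub>1 \<noteq> a\<^sub>2" "a\<^sub>1 \<noteq> a\<^sub>3" "a\<^sub>2 \<noteq> a\<^sub>3"
    and "normal_family D \<G>"
    and "\<And>h. limit_function D \<G> h \<Longrightarrow> \<not> h constant_on D"
    and "\<And>f. f \<in> \<F> \<Longrightarrow> \<exists>g\<in>\<G>. \<forall>a\<in>{a\<^sub>1, a\<^sub>2, a\<^sub>3}. shares_partially D f g a"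
  shows "normal_family D \<F>"
  unfolding normal_family_def
proof (intro allI impI)
  fix f :: "nat \<Rightarrow> complex \<Rightarrow> complex" assume "\<forall>n. f n \<in> \<F>"
  then have f: "f n \<in> \<F>" for n by blast
  have "\<forall>n. \<exists>g\<in>\<G>. \<forall>a\<in>{a\<^sub>1, a\<^sub>2, a\<^sub>3}. shares_partially D (f n) g a"
    using assms(11) f by blast
  then obtain g where g: "\<And>n. g n \<in> \<G>"
    "\<And>n a. a \<in> {a\<^sub>1, a\<^sub>2, a\<^sub>3} \<Longrightarrow> shares_partially D (f n) (g n) a"
    by metis
  obtain r h where r: "strict_mono r" and lim: "loc_uniform_limit D (\<lambda>n. sphere_val (g (r n))) h"
    using assms(9) g(1) unfolding normal_family_def by blast
  \<comment> \<open>The convergent subsequence of partners is itself a sequence in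
    \<open>\<G>\<close>, possibly with repetitions, so the assumption on limit functions reaches
    \<open>h\<close>.\<close>
  have "limit_function D \<G> h"
    unfolding limit_function_def by (rule exI[of _ "\<lambda>n. g (r n)"]) (simp add: g(1) lim)
  then have nonconst: "\<not> h constant_on D" by (rule assms(10))
  have h: "sphere_analytic_at h z" if z: "z \<in> D" for z
  proof -
    obtain U where U: "open U" "z \<in> U" "U \<subseteq> D"
      and limU: "uniform_limit U (\<lambda>n. sphere_val (g (r n))) h sequentially"
      using lim[unfolded loc_uniform_limit_def, rule_format, OF z] by (elim exE conjE)
    show ?thesis
    proof (rule sphere_analytic_at_uniform_limit[OF U(1,2) _ limU])
      show "sphere_analytic_at (sphere_val (g (r n))) w" if "w \<in> U" for n w
        using that U(3) by (intro sphere_analytic_at_sphere_val[OF assms(5)[OF g(1)]]) auto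
    qed
  qed
  have loc: "\<exists>U. open U \<and> z \<in> U \<and> U \<subseteq> D \<and> (\<forall>s :: nat \<Rightarrow> nat. strict_mono s \<longrightarrow>
      (\<exists>q k. strict_mono (q :: nat \<Rightarrow> nat) \<and> uniform_limit U (\<lambda>n. sphere_val (f (r (s (q n))))) k sequentially))"
    if z: "z \<in> D" for z
  proof -
    \<comment> \<open>Of three distinct values \<open>h z\<close> equals at most one; the
      relabelling calls that one \<open>c\<close>.\<close>
    obtain a b c where abc: "a \<noteq> b" "a \<noteq> c" "b \<noteq> c" "h z \<noteq> a" "h z \<noteq> b" "{a, b, c} = {a\<^sub>1, a\<^sub>2, a\<^sub>3}"
    proof -
      consider "h z \<noteq> a\<^sub>1 \<and> h z \<noteq> a\<^sub>2" | "h z \<noteq> a\<^sub>1 \<and> h z \<noteq> a\<^sub>3" | "h z \<noteq> a\<^sub>2 \<and> h z \<noteq> a\<^sub>3"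
        using assms(6-8) by metis
      then show ?thesis
        using that[of a\<^sub>1 a\<^sub>2 a\<^sub>3] that[of a\<^sub>1 a\<^sub>3 a\<^sub>2] that[of a\<^sub>2 a\<^sub>3 a\<^sub>1] assms(6-8)
        by cases auto
    qed
    show ?thesis
    proof (rule partial_sharing_local[OF assms(1) z abc(1-5) _ _ _ lim])
      show "sphere_analytic_at (sphere_val (f (r n))) w" if "w \<in> D" for n w
        by (rule sphere_analytic_at_sphere_val[OF assms(4)[OF f] that])
      show "isCont h w" if "w \<in> D" for w
        by (rule sphere_analytic_at_imp_isCont[OF h[OF that]])
      show "\<forall>\<^sub>F w in at z. h w \<noteq> c"
        by (rule sphere_analytic_identity[OF assms(1,2) h nonconst z])
      show "sphere_val (g (r n)) w = x"
        if "w \<in> D" "x \<in> {a, b, c}" "sphere_val (f (r n)) w = x" for n w x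
        using g(2)[of x "r n"] that abc(6) unfolding shares_partially_def value_points_def by blast
    qed
  qed
  \<comment> \<open>The local statement concerns subsequences of \<open>f\<close> along
    \<open>r\<close>, so the diagonal choice \<open>q\<close> is composed with
    \<open>r\<close>.\<close>
  obtain q k where "strict_mono q" "loc_uniform_limit D (\<lambda>n. sphere_val (f (r (q n)))) k"
    using diagonal_loc_uniform_limit[OF assms(3) loc] by blast
  then show "\<exists>r h. strict_mono (r :: nat \<Rightarrow> nat) \<and> loc_uniform_limit D (\<lambda>n. sphere_val (f (r n))) h"
    using strict_mono_o[OF r] by (intro exI[of _ "r \<circ> q"] exI[of _ k]) simp
qed

end
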